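(* For any $0<\alpha,\beta<1$ and any positive integer $t$, there are positive integers $k,\ell,s$ such that $\mathrm{Z}_{\alpha,\beta}(G^s(\ell,k))-\mathrm{Z}_{\alpha,\beta}(G^s(\ell,k)-xu_s)\ge t$.
   Context: All graphs are finite and simple. $G-e$ denotes the graph obtained from $G$ by deleting the edge $e$. For positive integers $\ell,k$, $G(\ell,k)$ is the graph obtained by identifying a degree-1 vertex of the path $P_{k+1}$ on $k+1$ vertices with the central vertex of the star $K_{1,\ell}$; the identified vertex is called $v$ and its neighbor on the path is called $x$. For a positive integer $s$, $G^s(\ell,k)$ is the graph obtained from $G(\ell,k)$ by adding $s$ new vertices $u_1,\dots,u_s$, each adjacent only to $x$. Let $\alpha,\beta$ be the transmission proportion and the transmission threshold, let $G$ be a graph and $B\subseteq V(G)$ a set of initially filled vertices. The transmission forcing process started from $B$ is defined as follows. Put $B_0=B$, $w_0(v)=1$ for $v\in B$ and $w_0(v)=0$ for $v\in V(G)\setminus B$. For $t\ge 1$, given the set $B_{t-1}$ of vertices filled at time $t-1$ and the weights $w_{t-1}$: for each unfilled vertex $u\in V(G)\setminus B_{t-1}$ let $\mathcal V_{t,u}$ be the set of all $v\in B_{t-1}$ such that $u$ is the only neighbor of $v$ in $V(G)\setminus B_{t-1}$ and $v\notin \mathcal V_{r,u'}$ for every $r<t$ and every $u'$ (each vertex transmits weight at most once); when $v\in\mathcal V_{t,u}$ we say $v$ forces $u$, written $v\to u$. Set $w_t(u)=w_{t-1}(u)+\sum_{v\in\mathcal V_{t,u}}\alpha\, w_{t-1}(v)$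 for $u\in V(G)\setminus B_{t-1}$ and $w_t(u)=w_{t-1}(u)$ for $u\in B_{t-1}$. Then $B_t=B_{t-1}\cup\{u\in V(G)\setminus B_{t-1} : w_t(u)\ge\beta\}$. The set $B$ is an $(\alpha,\beta)$-transmission zero forcing set of $G$ if $B_t=V(G)$ for some $t\ge 0$, and the $(\alpha,\beta)$-transmission zero forcing number $\mathrm{Z}_{\alpha,\beta}(G)$ is the minimum cardinality of such a set. *)

theory Defs
  imports Complex_Main "Graph_Theory.Pair_Digraph"
begin

text \<open>
  Finite simple graphs are the instances of the locale \<^locale>\<open>pair_graph\<close>: finite, loop-free
  digraphs without parallel arcs whose arc relation is symmetric. An edge between \<open>u\<close> and \<open>v\<close> is
  the pair of arcs \<open>(u, v)\<close>, \<open>(v, u)\<close>, so deleting an edge removes both arcs and keeps all vertices.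
\<close>

definition delete_edge :: "'a pair_pre_digraph \<Rightarrow> 'a \<Rightarrow> 'a \<Rightarrow> 'a pair_pre_digraph" where
  "delete_edge G u v = G\<lparr>parcs := parcs G - {(u, v), (v, u)}\<rparr>"

definition edges_of :: "'a rel \<Rightarrow> 'a rel" where
  "edges_of R = R \<union> R\<inverse>"


subsection \<open>The transmission forcing process\<close>

text \<open>
  A state \<open>(F, w, S)\<close> consists of the set \<open>F\<close> of filled vertices, the weights \<open>w\<close>, and the set \<open>S\<close>
  of vertices that have already transmitted their weight. \<open>forcers G F S u\<close> is empty unless \<open>u\<close> is
  an unfilled vertex.
\<close>

definition forcers :: "'a pair_pre_digraph \<Rightarrow> 'a set \<Rightarrow> 'a set \<Rightarrow> 'a \<Rightarrow> 'a set" where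
  "forcers G F S u = {v \<in> F. {y \<in> pverts G - F. v \<rightarrow>\<^bsub>G\<^esub> y} = {u} \<and> v \<notin> S}"

fun tzf_step :: "real \<Rightarrow> real \<Rightarrow> 'a pair_pre_digraph \<Rightarrow>
    'a set \<times> ('a \<Rightarrow> real) \<times> 'a set \<Rightarrow> 'a set \<times> ('a \<Rightarrow> real) \<times> 'a set" where
  "tzf_step \<alpha> \<beta> G (F, w, S) =
    (let w' = (\<lambda>u. if u \<in> pverts G - F then w u + (\<Sum>v\<in>forcers G F S u. \<alpha> * w v) else w u)
     in (F \<union> {u \<in> pverts G - F. w' u \<ge> \<beta>}, w', S \<union> (\<Union>u \<in> pverts G - F. forcers G F S u)))"

primrec tzf_state :: "real \<Rightarrow> real \<Rightarrow> 'a pair_pre_digraph \<Rightarrow> 'a set \<Rightarrow> nat \<Rightarrow>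
    'a set \<times> ('a \<Rightarrow> real) \<times> 'a set" where
  "tzf_state \<alpha> \<beta> G B 0 = (B, (\<lambda>v. if v \<in> B then 1 else 0), {})"
| "tzf_state \<alpha> \<beta> G B (Suc t) = tzf_step \<alpha> \<beta> G (tzf_state \<alpha> \<beta> G B t)"

definition filled :: "real \<Rightarrow> real \<Rightarrow> 'a pair_pre_digraph \<Rightarrow> 'a set \<Rightarrow> nat \<Rightarrow> 'a set" where
  "filled \<alpha> \<beta> G B t = fst (tzf_state \<alpha> \<beta> G B t)"

definition weight :: "real \<Rightarrow> real \<Rightarrow> 'a pair_pre_digraph \<Rightarrow> 'a set \<Rightarrow> nat \<Rightarrow> 'a \<Rightarrow> real" where
  "weight \<alpha> \<beta> G B t = fst (snd (tzf_state \<alpha> \<beta> G B t))"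

definition spent :: "real \<Rightarrow> real \<Rightarrow> 'a pair_pre_digraph \<Rightarrow> 'a set \<Rightarrow> nat \<Rightarrow> 'a set" where
  "spent \<alpha> \<beta> G B t = snd (snd (tzf_state \<alpha> \<beta> G B t))"

text \<open>The set \<open>\<V>\<^sub>t\<^sub>,\<^sub>u\<close> of vertices forcing \<open>u\<close> at time \<open>t \<ge> 1\<close>.\<close>

definition transmitters ::
    "real \<Rightarrow> real \<Rightarrow> 'a pair_pre_digraph \<Rightarrow> 'a set \<Rightarrow> nat \<Rightarrow> 'a \<Rightarrow> 'a set" where
  "transmitters \<alpha> \<beta> G B t u =
    forcers G (filled \<alpha> \<beta> G B (t - 1)) (spent \<alpha> \<beta> G B (t - 1)) u"

definition is_tzf_set :: "real \<Rightarrow> real \<Rightarrow> 'a pair_pre_digraph \<Rightarrow> 'a set \<Rightarrow> bool" where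
  "is_tzf_set \<alpha> \<beta> G B \<longleftrightarrow> B \<subseteq> pverts G \<and> (\<exists>t. filled \<alpha> \<beta> G B t = pverts G)"

definition tzf_number :: "real \<Rightarrow> real \<Rightarrow> 'a pair_pre_digraph \<Rightarrow> nat" where
  "tzf_number \<alpha> \<beta> G = Min (card ` {B. is_tzf_set \<alpha> \<beta> G B})"

text \<open>
  The recursion for \<open>B\<^sub>t\<close>, \<open>w\<^sub>t\<close> and \<open>\<V>\<^sub>t\<^sub>,\<^sub>u\<close> without the auxiliary set of spent vertices.
\<close>

lemma filled_0: "filled \<alpha> \<beta> G B 0 = B"
  and weight_0: "weight \<alpha> \<beta> G B 0 v = (if v \<in> B then 1 else 0)"
  by (simp_all add: filled_def weight_def)

lemma weight_Suc:
  "weight \<alpha> \<beta> G B (Suc t) u =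
    (if u \<in> pverts G - filled \<alpha> \<beta> G B t
     then weight \<alpha> \<beta> G B t u
       + (\<Sum>v \<in> transmitters \<alpha> \<beta> G B (Suc t) u. \<alpha> * weight \<alpha> \<beta> G B t v)
     else weight \<alpha> \<beta> G B t u)"
  by (cases "tzf_state \<alpha> \<beta> G B t")
    (simp add: filled_def weight_def spent_def transmitters_def Let_def)

lemma filled_Suc:
  "filled \<alpha> \<beta> G B (Suc t) = filled \<alpha> \<beta> G B t \<union>
    {u \<in> pverts G - filled \<alpha> \<beta> G B t. weight \<alpha> \<beta> G B (Suc t) u \<ge> \<beta>}"
  by (cases "tzf_state \<alpha> \<beta> G B t") (simp add: filled_def weight_def Let_def)

lemma spent_Suc:
  "spent \<alpha> \<beta> G B (Suc t) = spent \<alpha> \<beta> G B t \<union>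
    (\<Union>u \<in> pverts G - filled \<alpha> \<beta> G B t. transmitters \<alpha> \<beta> G B (Suc t) u)"
  by (cases "tzf_state \<alpha> \<beta> G B t")
    (simp add: filled_def spent_def transmitters_def Let_def)

lemma spent_eq: "spent \<alpha> \<beta> G B t = (\<Union>r \<in> {1..t}. \<Union>u. transmitters \<alpha> \<beta> G B r u)"
proof (induction t)
  case 0
  show ?case by (simp add: spent_def)
next
  case (Suc t)
  have "(\<Union>u \<in> pverts G - filled \<alpha> \<beta> G B t. transmitters \<alpha> \<beta> G B (Suc t) u)
      = (\<Union>u. transmitters \<alpha> \<beta> G B (Suc t) u)"
    by (auto simp: transmitters_def forcers_def)
  moreover have "{1..Suc t} = insert (Suc t) {1..t}"
    by auto
  ultimately show ?case
    by (simp only: spent_Suc Suc UN_insert Un_commute)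
qed

lemma transmitters_Suc:
  "transmitters \<alpha> \<beta> G B (Suc t) u =
    {v \<in> filled \<alpha> \<beta> G B t. {y \<in> pverts G - filled \<alpha> \<beta> G B t. v \<rightarrow>\<^bsub>G\<^esub> y} = {u}
      \<and> (\<forall>r \<in> {1..t}. \<forall>u'. v \<notin> transmitters \<alpha> \<beta> G B r u')}"
proof -
  have "v \<in> spent \<alpha> \<beta> G B t \<longleftrightarrow> (\<exists>r \<in> {1..t}. \<exists>u'. v \<in> transmitters \<alpha> \<beta> G B r u')" for v
    by (auto simp: spent_eq)
  then show ?thesis
    by (simp add: transmitters_def[of \<alpha> \<beta> G B "Suc t"] forcers_def)
qed

lemma is_tzf_set_pverts: "is_tzf_set \<alpha> \<beta> G (pverts G)"
  using filled_0[of \<alpha> \<beta> G "pverts G"] by (auto simp: is_tzf_set_def)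


subsection \<open>The graphs \<open>G\<^sup>s(\<ell>, k)\<close>\<close>

text \<open>
  \<open>Path_Vert 0\<close> is both an end of the path and the centre of the star; sharing this vertex in the
  union below performs the identification. It is the vertex \<open>v\<close>, and \<open>Path_Vert 1\<close> is \<open>x\<close>.
\<close>

datatype vertex = Path_Vert nat | Star_Leaf nat | Pendant nat

definition vert_x :: vertex where
  "vert_x = Path_Vert 1"

definition path_graph :: "nat \<Rightarrow> vertex pair_pre_digraph" where
  "path_graph n = \<lparr>pverts = Path_Vert ` {..<n},
     parcs = edges_of {(Path_Vert i, Path_Vert (Suc i)) | i. Suc i < n}\<rparr>"

definition star_graph :: "nat \<Rightarrow> vertex pair_pre_digraph" where
  "star_graph l = \<lparr>pverts = insert (Path_Vert 0) (Star_Leaf ` {1..l}),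
     parcs = edges_of {(Path_Vert 0, Star_Leaf i) | i. i \<in> {1..l}}\<rparr>"

definition broom :: "nat \<Rightarrow> nat \<Rightarrow> vertex pair_pre_digraph" where
  "broom l k = \<lparr>pverts = pverts (path_graph (k + 1)) \<union> pverts (star_graph l),
     parcs = parcs (path_graph (k + 1)) \<union> parcs (star_graph l)\<rparr>"

definition pendant_broom :: "nat \<Rightarrow> nat \<Rightarrow> nat \<Rightarrow> vertex pair_pre_digraph" where
  "pendant_broom s l k = \<lparr>pverts = pverts (broom l k) \<union> Pendant ` {1..s},
     parcs = parcs (broom l k) \<union> edges_of {(vert_x, Pendant i) | i. i \<in> {1..s}}\<rparr>"

lemmas pendant_broom_unfold =
  pendant_broom_def broom_def path_graph_def star_graph_def edges_of_def vert_x_def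

lemma pair_graphI:
  assumes fin: "finite (pverts G)" and arcs: "parcs G \<subseteq> pverts G \<times> pverts G"
    and "sym (parcs G)" and "\<And>v. (v, v) \<notin> parcs G"
  shows "pair_graph G"
proof
  show "finite (parcs G)"
    using fin arcs by (meson finite_SigmaI finite_subset)
  show "symmetric (with_proj G)"
    using assms(3) by (simp add: symmetric_def)
  show "fst e \<in> pverts G" "snd e \<in> pverts G" if "e \<in> parcs G" for e
    using arcs that by (auto simp: mem_Times_iff)
  show "fst e \<noteq> snd e" if "e \<in> parcs G" for e
    using assms(4)[of "fst e"] that by (cases e) auto
qed (rule fin)

lemma pair_graph_pendant_broom:
  assumes "k \<ge> 1"
  shows "pair_graph (pendant_broom s l k)"
proof (rule pair_graphI)
  show "finite (pverts (pendant_broom s l k))"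
    by (simp add: pendant_broom_unfold)
  show "sym (parcs (pendant_broom s l k))"
    by (simp add: pendant_broom_unfold sym_Un sym_Un_converse)
  show "(v, v) \<notin> parcs (pendant_broom s l k)" for v
    by (auto simp: pendant_broom_unfold)
  show "parcs (pendant_broom s l k)
      \<subseteq> pverts (pendant_broom s l k) \<times> pverts (pendant_broom s l k)"
    using assms by (auto simp: pendant_broom_unfold)
qed

lemma pair_graph_delete_edge:
  assumes "pair_graph G"
  shows "pair_graph (delete_edge G u v)"
proof (rule pair_graphI)
  interpret pair_graph G by fact
  show "finite (pverts (delete_edge G u v))"
    using pair_finite_verts by (simp add: delete_edge_def)
  have "sym (parcs G)"
    using pair_sym_arcs by (simp add: symmetric_def)
  then show "sym (parcs (delete_edge G u v))"
    by (auto simp: delete_edge_def sym_def)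
  show "(w, w) \<notin> parcs (delete_edge G u v)" for w
    using pair_no_loops[of "(w, w)"] by (auto simp add: delete_edge_def)
  show "parcs (delete_edge G u v) \<subseteq> pverts (delete_edge G u v) \<times> pverts (delete_edge G u v)"
    by (auto simp: delete_edge_def intro: in_arcsD1 in_arcsD2)
qed

end

theory Submission
  imports Defs
begin

text \<open>
  Let \<open>s\<close> be the least number of pendants that together can fill \<open>x\<close>, that is, \<open>\<alpha> (s - 1) < \<beta> \<le> \<alpha> s\<close>.
  Without the edge \<open>x u\<^sub>s\<close>, filling all star leaves and all pendants suffices if \<open>\<ell>\<close> is large enough
  for a long path: \<open>x\<close> stays unfilled until \<open>v\<close> transmits weight of order \<open>\<ell>\<close>. With the edge, \<open>x\<close>
  never passes on more than a bounded weight to the path: either it is initially filled, or it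
  spends its transmission on a pendant, or all pendants are initially filled and fill \<open>x\<close> immediately. Hence, however large \<open>\<ell>\<close>
  is, every sufficiently long piece of the path contains an initially filled vertex, while all
  but one of the leaves and all but one of the pendants are still needed.
\<close>

section \<open>General facts about the forcing process\<close>

locale transmission =
  fixes \<alpha> \<beta> :: real and G :: "'a pair_pre_digraph" and B :: "'a set"
  assumes alpha_pos: "0 < \<alpha>" and beta_pos: "0 < \<beta>"
    and finite_pverts: "finite (pverts G)" and B_subset: "B \<subseteq> pverts G"
begin

abbreviation "F \<equiv> filled \<alpha> \<beta> G B"
abbreviation "w \<equiv> weight \<alpha> \<beta> G B"
abbreviation "tr \<equiv> transmitters \<alpha> \<beta> G B"

text \<open>Transmission times start at 1, hence \<open>Suc r\<close>: the union covers the times 1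
  to \<open>n\<close>.\<close>

definition senders :: "nat \<Rightarrow> 'a \<Rightarrow> 'a set" where
  "senders n u = (\<Union>r<n. tr (Suc r) u)"

lemma F_mono: "m \<le> n \<Longrightarrow> F m \<subseteq> F n"
  by (rule lift_Suc_mono_le[of F]) (auto simp: filled_Suc)

lemma F_subset: "F n \<subseteq> pverts G"
  by (induction n) (use B_subset in \<open>auto simp: filled_0 filled_Suc\<close>)

lemma B_subset_F: "B \<subseteq> F n"
  using F_mono[of 0 n] by (simp add: filled_0)

lemma finite_F: "finite (F n)"
  using F_subset finite_pverts by (rule finite_subset)

lemma trD:
  assumes "v \<in> tr (Suc r) u"
  shows "v \<in> F r" "u \<in> pverts G" "u \<notin> F r" "(v, u) \<in> parcs G"
    and "\<And>y. (v, y) \<in> parcs G \<Longrightarrow> y \<in> pverts G \<Longrightarrow> y \<noteq> u \<Longrightarrow> y \<in> F r"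
  using assms by (auto simp: transmitters_Suc)

lemma finite_tr: "finite (tr (Suc r) u)"
  using trD(1) finite_F by (meson finite_subset subsetI)

text \<open>The later of two transmissions is excluded by the once-only condition in
  \<open>transmitters_Suc\<close>; at equal times the target is the only unfilled neighbor.\<close>

lemma tr_unique:
  assumes "v \<in> tr (Suc r) u" "v \<in> tr (Suc r') u'"
  shows "r = r'" "u = u'"
proof -
  have "\<not> a < b" if "v \<in> tr (Suc a) y" "v \<in> tr (Suc b) y'" for a b y y'
  proof
    assume "a < b"
    then have "Suc a \<in> {1..b}" by simp
    then show False
      using that by (auto simp: transmitters_Suc[of _ _ _ _ b])
  qed
  then show "r = r'"
    using assms by (meson linorder_neqE_nat)
  then show "u = u'"
    using assms by (auto simp: transmitters_Suc)
qed

text \<open>A vertex that is filled or outside the graph has no transmitters, so the case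
  distinction of \<open>weight_Suc\<close> disappears.\<close>

lemma weight_Suc_sum: "w (Suc n) u = w n u + (\<Sum>v\<in>tr (Suc n) u. \<alpha> * w n v)"
proof (cases "u \<in> pverts G - F n")
  case False
  then have "tr (Suc n) u = {}" using trD by blast
  with False show ?thesis by (simp add: weight_Suc)
qed (simp add: weight_Suc)

lemma weight_filled:
  assumes "u \<in> F m" "m \<le> n"
  shows "w n u = w m u"
  using assms(2)
proof (induction n rule: dec_induct)
  case (step n)
  then have "u \<in> F n" using F_mono assms(1) by blast
  then show ?case using step by (simp add: weight_Suc)
qed simp

text \<open>The index \<open>n - 1\<close> serves \<open>weight_senders\<close>: senders up to time
  \<open>Suc n\<close> already have their final weight at time \<open>n\<close>. For
  \<open>n = 0\<close> there are no senders.\<close>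

lemma senders_subset_F: "senders n u \<subseteq> F (n - 1)"
proof
  fix v assume "v \<in> senders n u"
  then obtain r where "r < n" "v \<in> tr (Suc r) u" by (auto simp: senders_def)
  then show "v \<in> F (n - 1)" using trD(1) F_mono[of r "n - 1"] by fastforce
qed

lemma senders_in_F: "v \<in> senders n u \<Longrightarrow> v \<in> F n"
  using senders_subset_F F_mono[of "n - 1" n] by force

lemma senders_arc: "v \<in> senders n u \<Longrightarrow> (v, u) \<in> parcs G"
  by (auto simp: senders_def dest: trD(4))

lemma finite_senders: "finite (senders n u)"
  using senders_subset_F finite_F finite_subset by blast

lemma senders_B: "u \<in> B \<Longrightarrow> senders n u = {}"
  using trD(3) B_subset_F by (fastforce simp: senders_def)

text \<open>A sender is filled when it transmits and its weight is frozen from then on, so the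
  amount sent can be read off from its current weight.\<close>

lemma weight_senders: "w n u = (if u \<in> B then 1 else 0) + (\<Sum>v\<in>senders n u. \<alpha> * w n v)"
proof (induction n)
  case 0
  show ?case by (simp add: weight_0 senders_def)
next
  case (Suc n)
  have eq: "senders (Suc n) u = senders n u \<union> tr (Suc n) u"
    by (auto simp: senders_def less_Suc_eq)
  have disj: "senders n u \<inter> tr (Suc n) u = {}"
    using tr_unique(1) by (fastforce simp: senders_def)
  have const: "w (Suc n) v = w n v" if "v \<in> senders (Suc n) u" for v
    using that senders_subset_F[of "Suc n" u] by (intro weight_filled) auto
  have "(\<Sum>v\<in>senders (Suc n) u. \<alpha> * w (Suc n) v) = (\<Sum>v\<in>senders (Suc n) u. \<alpha> * w n v)"
    by (intro sum.cong) (auto simp: const)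
  also have "\<dots> = (\<Sum>v\<in>senders n u. \<alpha> * w n v) + (\<Sum>v\<in>tr (Suc n) u. \<alpha> * w n v)"
    using finite_senders[of "Suc n" u] disj unfolding eq by (intro sum.union_disjoint) auto
  finally show ?case using Suc by (simp add: weight_Suc_sum)
qed

lemma weight_nonneg: "0 \<le> w n u"
  by (induction n arbitrary: u)
    (use alpha_pos in \<open>auto simp: weight_0 weight_Suc_sum intro!: add_nonneg_nonneg sum_nonneg\<close>)

lemma weight_filled_ge:
  assumes "u \<in> F n" "u \<notin> B"
  shows "\<beta> \<le> w n u"
  using assms(1)
proof (induction n)
  case 0
  then show ?case using assms by (simp add: filled_0)
next
  case (Suc n)
  show ?case
  proof (cases "u \<in> F n")
    case True
    then show ?thesis using Suc.IH weight_filled[OF True, of "Suc n"] by simp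
  next
    case False
    then show ?thesis using Suc.prems by (simp add: filled_Suc)
  qed
qed

text \<open>Without senders the weight outside \<open>B\<close> would be 0, below the positive
  threshold.\<close>

lemma filled_has_sender:
  assumes "u \<in> F n" "u \<notin> B"
  shows "senders n u \<noteq> {}"
  using weight_filled_ge[OF assms] weight_senders[of n u] assms(2) beta_pos by auto

text \<open>Every vertex transmits at most once, so a centre can fill at most one of its leaves.\<close>

lemma card_unfilled_leaves:
  assumes "F n = pverts G" "S \<subseteq> pverts G"
    and leaf: "\<And>u v. u \<in> S \<Longrightarrow> (v, u) \<in> parcs G \<Longrightarrow> v = c"
  shows "card S \<le> Suc (card (S \<inter> B))"
proof -
  have fin: "finite S"
    using assms(1,2) finite_F finite_subset by metis
  have "u = u'" if "u \<in> S - B" "u' \<in> S - B" for u u'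
  proof -
    have *: "\<exists>r. c \<in> tr (Suc r) y" if "y \<in> S - B" for y
    proof -
      obtain v where "v \<in> senders n y"
        using filled_has_sender[of y n] assms(1,2) \<open>y \<in> S - B\<close> by auto
      moreover from this have "v = c"
        using senders_arc leaf \<open>y \<in> S - B\<close> by blast
      ultimately show ?thesis by (auto simp: senders_def)
    qed
    show ?thesis using *[OF that(1)] *[OF that(2)] tr_unique(2) by blast
  qed
  then have "card (S - B) \<le> Suc 0"
    using fin by (auto simp: card_le_Suc0_iff_eq)
  then show ?thesis
    using card_Int_Diff[OF fin, of B] by simp
qed

text \<open>
  While \<open>q (j + 1)\<close> is unfilled, \<open>q j\<close> can have received weight from \<open>q (j - 1)\<close> only. So along a
  stretch of a path the weights decay geometrically in the direction of propagation, and they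
  do so in both directions separately.
\<close>

lemma path_weight_le:
  assumes nbrs: "\<And>j z. j < m \<Longrightarrow> (z, q (Suc j)) \<in> parcs G \<Longrightarrow> z = q j \<or> z = q (Suc (Suc j))"
    and start: "\<And>n. q (Suc 0) \<notin> F n \<Longrightarrow> w n (q 0) \<le> c 0"
    and decay: "\<And>j. j < m \<Longrightarrow> \<alpha> * c j \<le> c (Suc j)"
    and nonneg: "\<And>j. 0 \<le> c j"
    and initial: "\<And>j. j < m \<Longrightarrow> q (Suc j) \<in> B \<Longrightarrow> 1 \<le> c (Suc j)"
    and "j \<le> m" "q (Suc j) \<notin> F n"
  shows "w n (q j) \<le> c j"
  using assms(6,7)
proof (induction j arbitrary: n)
  case 0
  then show ?case using start by simp
next
  case (Suc j)
  show ?case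
  proof (cases "q (Suc j) \<in> B")
    case True
    then show ?thesis
      using initial[of j] Suc.prems(1) weight_senders[of n "q (Suc j)"] senders_B by simp
  next
    case False
    have sub: "senders n (q (Suc j)) \<subseteq> {q j}"
    proof
      fix z assume "z \<in> senders n (q (Suc j))"
      then show "z \<in> {q j}"
        using nbrs[of j z] senders_arc senders_in_F Suc.prems by fastforce
    qed
    show ?thesis
    proof (cases "senders n (q (Suc j)) = {}")
      case True
      then show ?thesis using False weight_senders[of n "q (Suc j)"] nonneg by simp
    next
      case nonempty: False
      then have S: "senders n (q (Suc j)) = {q j}" using sub by blast
      then obtain r where r: "r < n" "q j \<in> tr (Suc r) (q (Suc j))"
        by (auto simp: senders_def)
      \<comment> \<open>The bound on \<open>q j\<close> is available only while
        \<open>q (Suc j)\<close> is unfilled, so it is applied at the transmission time; the weight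
        of \<open>q j\<close> does not change afterwards.\<close>
      have "w n (q j) = w r (q j)"
        using weight_filled[OF trD(1)[OF r(2)], of n] r(1) by simp
      also have "\<dots> \<le> c j"
        using Suc.IH trD(3)[OF r(2)] Suc.prems(1) by simp
      finally have "\<alpha> * w n (q j) \<le> \<alpha> * c j"
        using alpha_pos by simp
      then show ?thesis
        using decay[of j] Suc.prems(1) weight_senders[of n "q (Suc j)"] False S by simp
    qed
  qed
qed

text \<open>If the window avoided \<open>B\<close>, its middle vertex would be filled from a
  neighbor lying \<open>L\<close> steps from one of the outer vertices \<open>p a\<close> and
  \<open>p (a + 2 * L + 2)\<close>. Decay leaves that neighbor at most
  \<open>\<alpha> ^ L * M\<close>, less than the threshold it must itself have reached.\<close>

lemma path_window_meets_B:
  assumes filled: "F N = pverts G" and verts: "p (a + L + 1) \<in> pverts G"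
    and nbrs: "\<And>i z. a < i \<Longrightarrow> i \<le> a + 2 * L + 1 \<Longrightarrow> (z, p i) \<in> parcs G \<Longrightarrow>
      z = p (i - 1) \<or> z = p (i + 1)"
    and left: "\<And>n. p (a + 1) \<notin> F n \<Longrightarrow> w n (p a) \<le> M"
    and right: "\<And>n. p (a + 2 * L + 1) \<notin> F n \<Longrightarrow> w n (p (a + 2 * L + 2)) \<le> M"
    and "0 \<le> M" "0 < L" "\<alpha> ^ L * M < \<beta>"
  shows "\<exists>i\<in>{a<..a + 2 * L + 1}. p i \<in> B"
proof (rule ccontr)
  assume "\<not> ?thesis"
  then have not_B: "p i \<notin> B" if "a < i" "i \<le> a + 2 * L + 1" for i
    using that by auto
  define y where "y = p (a + L + 1)"
  have "y \<in> F N" "y \<notin> B"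
    using filled verts not_B by (auto simp: y_def)
  then obtain z where "z \<in> senders N y"
    using filled_has_sender by blast
  then obtain r where r: "z \<in> tr (Suc r) y"
    by (auto simp: senders_def)
  have z: "z = p (a + L) \<or> z = p (a + L + 2)"
    using nbrs[of "a + L + 1" z] trD(4)[OF r] by (simp add: y_def)
  \<comment> \<open>\<open>0 < L\<close> places both candidates inside the window.\<close>
  then have "z \<notin> B"
    using not_B[of "a + L"] not_B[of "a + L + 2"] assms(7) by auto
  then have "\<beta> \<le> w r z"
    by (rule weight_filled_ge[OF trD(1)[OF r]])
  moreover have "w r (p (a + L)) \<le> \<alpha> ^ L * M"
  proof -
    have "w r (p (a + L)) \<le> (\<lambda>j. \<alpha> ^ j * M) L"
    proof (rule path_weight_le[where q = "\<lambda>j. p (a + j)" and m = L])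
      fix j z assume "j < L" "(z, p (a + Suc j)) \<in> parcs G"
      then show "z = p (a + j) \<or> z = p (a + Suc (Suc j))"
        using nbrs[of "a + Suc j" z] by simp
    qed (use left not_B trD(3)[OF r] alpha_pos assms(6) in \<open>auto simp: y_def\<close>)
    then show ?thesis by simp
  qed
  moreover have "w r (p (a + L + 2)) \<le> \<alpha> ^ L * M"
  proof -
    \<comment> \<open>The same estimate with the path read backwards from its right outer
      vertex.\<close>
    have "w r (p (a + 2 * L + 2 - L)) \<le> (\<lambda>j. \<alpha> ^ j * M) L"
    proof (rule path_weight_le[where q = "\<lambda>j. p (a + 2 * L + 2 - j)" and m = L])
      fix j z assume "j < L" "(z, p (a + 2 * L + 2 - Suc j)) \<in> parcs G"
      then show "z = p (a + 2 * L + 2 - j) \<or> z = p (a + 2 * L + 2 - Suc (Suc j))"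
        using nbrs[of "a + 2 * L + 1 - j" z] by (auto simp: Suc_diff_le)
    next
      fix j assume "j < L" "p (a + 2 * L + 2 - Suc j) \<in> B"
      then show "1 \<le> \<alpha> ^ Suc j * M"
        using not_B[of "a + 2 * L + 2 - Suc j"] by linarith
    next
      show "p (a + 2 * L + 2 - Suc L) \<notin> F r"
        using trD(3)[OF r] by (simp add: y_def add.commute)
    qed (use right alpha_pos assms(6) in auto)
    then show ?thesis by (simp add: add.commute)
  qed
  ultimately show False
    using z assms(8) by (elim disjE) simp_all
qed

end

section \<open>Vertices and adjacency of pendant brooms\<close>

lemma mem_pverts_pendant_broom:
  "Path_Vert i \<in> pverts (pendant_broom s l k) \<longleftrightarrow> i \<le> k"
  "Star_Leaf i \<in> pverts (pendant_broom s l k) \<longleftrightarrow> i \<in> {1..l}"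
  "Pendant i \<in> pverts (pendant_broom s l k) \<longleftrightarrow> i \<in> {1..s}"
  by (auto simp: pendant_broom_unfold)

lemma finite_pverts_pendant_broom: "finite (pverts (pendant_broom s l k))"
  by (simp add: pendant_broom_unfold)

lemma parcs_pendant_broom_Pendant:
  "(Pendant i, y) \<in> parcs (pendant_broom s l k) \<longleftrightarrow> i \<in> {1..s} \<and> y = Path_Vert 1"
  "(y, Pendant i) \<in> parcs (pendant_broom s l k) \<longleftrightarrow> i \<in> {1..s} \<and> y = Path_Vert 1"
  by (auto simp: pendant_broom_unfold)

lemma parcs_pendant_broom_Star_Leaf:
  "(Star_Leaf i, y) \<in> parcs (pendant_broom s l k) \<longleftrightarrow> i \<in> {1..l} \<and> y = Path_Vert 0"
  "(y, Star_Leaf i) \<in> parcs (pendant_broom s l k) \<longleftrightarrow> i \<in> {1..l} \<and> y = Path_Vert 0"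
  by (auto simp: pendant_broom_unfold)

lemma parcs_pendant_broom_Path_Vert:
  "(Path_Vert i, Path_Vert j) \<in> parcs (pendant_broom s l k)
    \<longleftrightarrow> i \<le> k \<and> j \<le> k \<and> (j = Suc i \<or> i = Suc j)"
  by (auto simp: pendant_broom_unfold)

lemmas parcs_pendant_broom =
  parcs_pendant_broom_Pendant parcs_pendant_broom_Star_Leaf parcs_pendant_broom_Path_Vert

lemma pendant_broom_path_nbrs:
  assumes "(z, Path_Vert i) \<in> parcs (pendant_broom s l k)" "2 \<le> i"
  shows "z = Path_Vert (i - 1) \<or> z = Path_Vert (i + 1)"
  using assms by (cases z) (auto simp: parcs_pendant_broom)

section \<open>The lower bound while the edge is present\<close>

text \<open>When \<open>x\<close> transmits to the path, every pendant is filled, and none of them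
  by \<open>x\<close>, so all are in \<open>B\<close>. If \<open>x\<close> is not initially filled,
  they fill it at time 1, after which its weight is frozen; at most its \<open>s + 2\<close>
  neighbors have contributed.\<close>

lemma weight_vert_x_le:
  assumes "transmission \<alpha> \<beta> (pendant_broom s l k) B" and s: "\<beta> \<le> \<alpha> * real s" and "\<alpha> < 1"
    and sender: "Path_Vert 1 \<in> transmission.senders \<alpha> \<beta> (pendant_broom s l k) B n (Path_Vert 2)"
  shows "weight \<alpha> \<beta> (pendant_broom s l k) B n (Path_Vert 1) \<le> real s + 3"
proof -
  define G where "G = pendant_broom s l k"
  interpret transmission \<alpha> \<beta> G B
    using assms(1) by (simp add: G_def)
  note broom = mem_pverts_pendant_broom[of _ s l k, folded G_def]
    parcs_pendant_broom[of _ _ s l k, folded G_def]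
  obtain r where r: "r < n" "Path_Vert 1 \<in> tr (Suc r) (Path_Vert 2)"
    using sender by (auto simp: senders_def simp flip: G_def)
  have k: "k \<ge> 2" using trD(2)[OF r(2)] by (simp add: broom)
  have pend: "Pendant i \<in> B" if "i \<in> {1..s}" for i
  proof (rule ccontr)
    assume "Pendant i \<notin> B"
    moreover have "Pendant i \<in> F r"
      using trD(5)[OF r(2)] that k by (simp add: broom)
    ultimately obtain z where z: "z \<in> senders r (Pendant i)"
      using filled_has_sender by blast
    then have "z = Path_Vert 1"
      using senders_arc[OF z] by (simp add: broom)
    then obtain r' where "Path_Vert 1 \<in> tr (Suc r') (Pendant i)"
      using z by (auto simp: senders_def)
    then show False using tr_unique(2)[OF r(2)] by blast
  qed
  show ?thesis
  proof (cases "Path_Vert 1 \<in> B")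
    case True
    then show ?thesis
      using weight_senders[of n "Path_Vert 1"] senders_B by (simp add: G_def)
  next
    case False
    let ?S = "Pendant ` {1..s}"
    have pend_tr: "?S \<subseteq> tr (Suc 0) (Path_Vert 1)"
      using pend False k by (auto simp: transmitters_Suc filled_0 broom)
    \<comment> \<open>Only vertices of \<open>B\<close> transmit at time 1, each having weight 1, so
      the weight counts the transmitters.\<close>
    have w1: "w 1 (Path_Vert 1) = \<alpha> * real (card (tr (Suc 0) (Path_Vert 1)))"
      using False trD(1)[of _ 0 "Path_Vert 1"]
      by (simp add: weight_Suc_sum weight_0 filled_0)
    have fin: "finite (tr (Suc 0) (Path_Vert 1))"
      by (rule finite_tr)
    have "card ?S = s"
      by (simp add: card_image inj_on_def)
    then have "s \<le> card (tr (Suc 0) (Path_Vert 1))"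
      using card_mono[OF fin pend_tr] by simp
    then have "\<alpha> * real s \<le> w 1 (Path_Vert 1)"
      using w1 alpha_pos by simp
    then have "Path_Vert 1 \<in> F 1"
      using s False k by (simp add: filled_Suc filled_0 broom)
    then have "w n (Path_Vert 1) = w 1 (Path_Vert 1)"
      using r(1) by (intro weight_filled) auto
    also have "\<dots> \<le> real (card (tr (Suc 0) (Path_Vert 1)))"
      using w1 \<open>\<alpha> < 1\<close> alpha_pos by (simp add: mult_left_le_one_le)
    also have "tr (Suc 0) (Path_Vert 1) \<subseteq> ?S \<union> {Path_Vert 0, Path_Vert 2}"
    proof
      fix z assume "z \<in> tr (Suc 0) (Path_Vert 1)"
      then show "z \<in> ?S \<union> {Path_Vert 0, Path_Vert 2}"
        using trD(4)[of z 0 "Path_Vert 1"] by (cases z) (auto simp: broom)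
    qed
    then have "card (tr (Suc 0) (Path_Vert 1)) \<le> card (?S \<union> {Path_Vert 0, Path_Vert 2})"
      by (rule card_mono[rotated]) simp
    also have "\<dots> \<le> card ?S + card {Path_Vert 0, Path_Vert 2}"
      by (rule card_Un_le)
    also have "\<dots> = s + 2"
      using \<open>card ?S = s\<close> by simp
    finally show ?thesis by (simp add: G_def)
  qed
qed

text \<open>\<open>B\<close> contains all but at most one of the leaves, all but at most one of the
  pendants, and a vertex in each of \<open>m\<close> disjoint windows of \<open>2 * L + 1\<close>
  path vertices. The windows cover the positions 3 to \<open>k - 1\<close>; positions 2 and
  \<open>k\<close> are the outer vertices of the first and the last window.\<close>

lemma card_tzf_set_pendant_broom:
  assumes "0 < \<alpha>" "\<alpha> < 1" "0 < \<beta>" and s: "\<beta> \<le> \<alpha> * real s"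
    and L: "0 < L" "\<alpha> ^ L * (real s + 3) < \<beta>" and k: "k = 3 + m * (2 * L + 1)"
    and tzf: "is_tzf_set \<alpha> \<beta> (pendant_broom s l k) B"
  shows "l + s + m \<le> card B + 2"
proof -
  define G where "G = pendant_broom s l k"
  interpret transmission \<alpha> \<beta> G B
    using assms by unfold_locales (auto simp: G_def is_tzf_set_def finite_pverts_pendant_broom)
  note broom = mem_pverts_pendant_broom[of _ s l k, folded G_def]
    parcs_pendant_broom[of _ _ s l k, folded G_def]
  note nbrs = pendant_broom_path_nbrs[of _ _ s l k, folded G_def]
  obtain N where N: "F N = pverts G"
    using tzf by (auto simp: is_tzf_set_def G_def)
  have "finite B" using finite_F[of 0] by (simp add: filled_0)
  define M where "M = real s + 3"
  \<comment> \<open>The names give the direction of travel: \<open>right\<close> supplies the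
    premise \<open>left\<close> of \<open>path_window_meets_B\<close> and conversely. The bound
    starts at \<open>Path_Vert 2\<close>, which can get weight only from \<open>x\<close> as long as
    \<open>Path_Vert 3\<close> is unfilled.\<close>
  have right: "w n (Path_Vert i) \<le> M" if "Path_Vert (i + 1) \<notin> F n" "2 \<le> i" for n i
  proof -
    obtain j where j: "i = 2 + j" using \<open>2 \<le> i\<close> le_Suc_ex by blast
    have "w n (Path_Vert (2 + j)) \<le> (\<lambda>_. M) j"
    proof (rule path_weight_le[where q = "\<lambda>j. Path_Vert (2 + j)" and m = j])
      fix j z assume "(z, Path_Vert (2 + Suc j)) \<in> parcs G"
      then show "z = Path_Vert (2 + j) \<or> z = Path_Vert (2 + Suc (Suc j))"
        using nbrs[of z "2 + Suc j"] by simp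
    next
      fix n assume unf: "Path_Vert (2 + Suc 0) \<notin> F n"
      show "w n (Path_Vert (2 + 0)) \<le> M"
      proof (cases "Path_Vert 2 \<in> B \<or> senders n (Path_Vert 2) = {}")
        case True
        then show ?thesis
          using senders_B weight_senders[of n "Path_Vert 2"] by (auto simp: M_def)
      next
        case False
        have "z = Path_Vert 1" if "z \<in> senders n (Path_Vert 2)" for z
          using nbrs[of z 2] senders_arc[OF that] senders_in_F[OF that] unf by auto
        then have S: "senders n (Path_Vert 2) = {Path_Vert 1}" using False by blast
        then have le: "w n (Path_Vert 1) \<le> M"
          using weight_vert_x_le[of \<alpha> \<beta> s l k B n] transmission_axioms s \<open>\<alpha> < 1\<close>
          by (simp add: G_def M_def)
        have "\<alpha> * w n (Path_Vert 1) \<le> w n (Path_Vert 1)"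
          using weight_nonneg alpha_pos \<open>\<alpha> < 1\<close> by (simp add: mult_left_le_one_le)
        then show ?thesis
          using le S False weight_senders[of n "Path_Vert 2"] by simp
      qed
    qed (use j that(1) \<open>\<alpha> < 1\<close> alpha_pos in \<open>auto simp: M_def mult_left_le_one_le\<close>)
    then show ?thesis using j by simp
  qed
  \<comment> \<open>The end \<open>Path_Vert k\<close> receives nothing while its only neighbor is
    unfilled, so weight travelling towards \<open>x\<close> starts at an initially filled vertex and
    is at most 1.\<close>
  have left: "w n (Path_Vert i) \<le> 1" if "Path_Vert (i - 1) \<notin> F n" "2 \<le> i" "i \<le> k" for n i
  proof -
    have "w n (Path_Vert (k - (k - i))) \<le> (\<lambda>_. 1) (k - i)"
    proof (rule path_weight_le[where q = "\<lambda>j. Path_Vert (k - j)" and m = "k - i"])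
      fix j z assume "j < k - i" "(z, Path_Vert (k - Suc j)) \<in> parcs G"
      then show "z = Path_Vert (k - j) \<or> z = Path_Vert (k - Suc (Suc j))"
        using nbrs[of z "k - Suc j"] that by (auto simp: Suc_diff_Suc)
    next
      fix n assume unf: "Path_Vert (k - Suc 0) \<notin> F n"
      have "z \<notin> senders n (Path_Vert k)" for z
        using nbrs[of z k] senders_arc[of z] senders_in_F[of z] unf k
          F_subset[of n] broom(1)[of "k + 1"] by fastforce
      then have "senders n (Path_Vert k) = {}" by blast
      then show "w n (Path_Vert (k - 0)) \<le> 1"
        using weight_senders[of n "Path_Vert k"] by simp
    qed (use that \<open>\<alpha> < 1\<close> in auto)
    then show ?thesis using that by simp
  qed
  have "\<exists>i\<in>{2 + j * (2 * L + 1)<..2 + j * (2 * L + 1) + 2 * L + 1}. Path_Vert i \<in> B"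
    if "j < m" for j
  proof -
    define a where "a = 2 + j * (2 * L + 1)"
    have "Suc j * (2 * L + 1) \<le> m * (2 * L + 1)"
      using that by (intro mult_le_mono1) simp
    then have a: "a + 2 * L + 2 \<le> k"
      by (simp add: a_def k)
    show ?thesis
      unfolding a_def[symmetric]
    proof (rule path_window_meets_B[OF N, where M = M])
      fix n assume "Path_Vert (a + 2 * L + 1) \<notin> F n"
      then show "w n (Path_Vert (a + 2 * L + 2)) \<le> M"
        using left[of "a + 2 * L + 2" n] a by (simp add: M_def)
    next
      fix n assume "Path_Vert (a + 1) \<notin> F n"
      then show "w n (Path_Vert a) \<le> M"
        using right[of a n] by (simp add: a_def)
    next
      show "z = Path_Vert (i - 1) \<or> z = Path_Vert (i + 1)"
        if "a < i" "(z, Path_Vert i) \<in> parcs G" for i z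
        using nbrs[OF that(2)] that(1) by (simp add: a_def)
    qed (use a L in \<open>auto simp: broom M_def\<close>)
  qed
  then obtain f where f: "\<And>j. j < m \<Longrightarrow> 2 + j * (2 * L + 1) < f j"
      "\<And>j. j < m \<Longrightarrow> f j \<le> 2 + j * (2 * L + 1) + 2 * L + 1"
      "\<And>j. j < m \<Longrightarrow> Path_Vert (f j) \<in> B"
    by (metis greaterThanAtMost_iff)
  \<comment> \<open>The windows are disjoint and ordered, so the chosen vertices are
    distinct.\<close>
  have "f i < f j" if "i < j" "j < m" for i j
  proof -
    have "Suc i * (2 * L + 1) \<le> j * (2 * L + 1)"
      using that by (intro mult_le_mono1) simp
    then show ?thesis using f(1)[of j] f(2)[of i] that by simp
  qed
  then have "inj_on f {..<m}"
    by (metis inj_onI lessThan_iff linorder_neqE_nat less_irrefl)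
  then have "card ((Path_Vert \<circ> f) ` {..<m}) = m"
    by (subst card_image) (auto simp: inj_on_def)
  let ?P = "(Path_Vert \<circ> f) ` {..<m}"
  let ?S = "Star_Leaf ` {1..l}" and ?U = "Pendant ` {1..s}"
  have "card ?S \<le> Suc (card (?S \<inter> B))"
    by (rule card_unfilled_leaves[OF N, where c = "Path_Vert 0"]) (auto simp: broom)
  moreover have "card ?U \<le> Suc (card (?U \<inter> B))"
    by (rule card_unfilled_leaves[OF N, where c = "Path_Vert 1"]) (auto simp: broom)
  moreover have "card ?S = l" "card ?U = s"
    by (simp_all add: card_image inj_on_def)
  moreover have "card (?P \<union> (?S \<inter> B) \<union> (?U \<inter> B)) \<le> card B"
    using f(3) \<open>finite B\<close> by (intro card_mono) auto
  moreover have "card (?P \<union> (?S \<inter> B) \<union> (?U \<inter> B)) = card ?P + card (?S \<inter> B) + card (?U \<inter> B)"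
    using \<open>finite B\<close> by (subst card_Un_disjoint; auto)+
  ultimately show ?thesis using \<open>card ?P = m\<close> by simp
qed

section \<open>The upper bound after deleting the edge\<close>

text \<open>The leaves fill \<open>v\<close> at time 1 while the \<open>s - 1\<close> pendants still
  attached fail to fill \<open>x\<close>. Hence \<open>v\<close> can pass its weight on to
  \<open>x\<close>, and weight travels down the path, losing at most a factor
  \<open>\<alpha>\<close> per step; \<open>l\<close> is so large that even
  \<open>Path_Vert k\<close> reaches the threshold.\<close>

lemma is_tzf_set_delete_edge_pendant_broom:
  assumes "0 < \<alpha>" "\<alpha> < 1" "0 < \<beta>" and "0 < s" and s: "\<alpha> * real (s - 1) < \<beta>"
    and l: "\<beta> \<le> \<alpha> ^ (k + 1) * real l"
  shows "is_tzf_set \<alpha> \<beta> (delete_edge (pendant_broom s l k) vert_x (Pendant s))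
    (Star_Leaf ` {1..l} \<union> Pendant ` {1..s})"
proof -
  define G where "G = delete_edge (pendant_broom s l k) vert_x (Pendant s)"
  define B where "B = Star_Leaf ` {1..l} \<union> Pendant ` {1..s}"
  have pverts: "pverts G = pverts (pendant_broom s l k)"
    by (simp add: G_def delete_edge_def)
  have parcs: "parcs G = parcs (pendant_broom s l k) -
      {(Path_Vert 1, Pendant s), (Pendant s, Path_Vert 1)}"
    by (simp add: G_def delete_edge_def vert_x_def)
  note broom = pverts parcs mem_pverts_pendant_broom parcs_pendant_broom
  interpret transmission \<alpha> \<beta> G B
    using assms by unfold_locales (auto simp: B_def broom finite_pverts_pendant_broom)
  have path_in_B: "Path_Vert i \<notin> B" for i
    by (auto simp: B_def)
  have pverts_eq: "pverts G = B \<union> Path_Vert ` {..k}"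
    by (auto simp: B_def pverts pendant_broom_unfold)
  have big: "\<beta> \<le> \<alpha> ^ (n + 1) * real l" if "n \<le> k" for n
  proof -
    have "\<alpha> ^ (k + 1) * real l \<le> \<alpha> ^ (n + 1) * real l"
      using that \<open>0 < \<alpha>\<close> \<open>\<alpha> < 1\<close> by (intro mult_right_mono power_decreasing) auto
    then show ?thesis using l by linarith
  qed
  \<comment> \<open>The filled set must be known exactly: a front vertex needs an unfilled successor
    to hand its weight on. The induction is strong because a step uses the filled sets at two
    earlier times.\<close>
  have inv: "F n = B \<union> Path_Vert ` {..<n} \<and>
      (\<forall>i. n = Suc i \<longrightarrow> \<alpha> ^ n * real l \<le> w n (Path_Vert i))" if "n \<le> k + 1" for n
    using that
  proof (induction n rule: less_induct)
    case (less n)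
    show ?case
    proof (cases n)
      case 0
      then show ?thesis by (simp add: filled_0)
    next
      case (Suc m)
      have m: "m \<le> k" using less.prems Suc by simp
      have Fm: "F m = B \<union> Path_Vert ` {..<m}"
        using less.IH[of m] Suc less.prems by simp
      have head: "\<alpha> ^ Suc m * real l \<le> w (Suc m) (Path_Vert m)"
      proof (cases m)
        case 0
        have sub: "Star_Leaf ` {1..l} \<subseteq> tr (Suc 0) (Path_Vert 0)"
          by (auto simp: transmitters_Suc filled_0 broom B_def)
        have fin: "finite (tr (Suc 0) (Path_Vert 0))"
          by (rule finite_tr)
        have "l \<le> card (tr (Suc 0) (Path_Vert 0))"
          using card_mono[OF fin sub] by (simp add: card_image inj_on_def)
        moreover have "w 1 (Path_Vert 0) = \<alpha> * real (card (tr (Suc 0) (Path_Vert 0)))"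
          using trD(1)[of _ 0 "Path_Vert 0"] path_in_B
          by (simp add: weight_Suc_sum weight_0 filled_0)
        ultimately show ?thesis using 0 \<open>0 < \<alpha>\<close> by simp
      next
        case m': (Suc i)
        have wi: "\<alpha> ^ m * real l \<le> w m (Path_Vert i)"
          using less.IH[of m] Suc less.prems m' by simp
        have Fi: "F i = B \<union> Path_Vert ` {..<i}"
          using less.IH[of i] Suc less.prems m' by simp
        \<comment> \<open>\<open>Path_Vert i\<close> is first filled at time
          \<open>m = Suc i\<close>, so it cannot have spent its transmission yet.\<close>
        have "Path_Vert i \<notin> tr r u" if "r \<in> {1..m}" for r u
        proof
          assume "Path_Vert i \<in> tr r u"
          then have "Path_Vert i \<in> F (r - 1)"
            using trD(1)[of _ "r - 1" u] that by simp
          then have "Path_Vert i \<in> F i"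
            using F_mono[of "r - 1" i] that m' by fastforce
          then show False using Fi path_in_B by auto
        qed
        moreover have "y = Path_Vert m"
          if "y \<in> pverts G" "y \<notin> F m" "(Path_Vert i, y) \<in> parcs G" for y
          using that Fm m' by (cases y) (auto simp: broom B_def)
        moreover have "Path_Vert i \<in> F m" "Path_Vert m \<notin> F m"
            "Path_Vert m \<in> pverts G" "(Path_Vert i, Path_Vert m) \<in> parcs G"
          using Fm path_in_B m m' by (auto simp: broom)
        ultimately have "Path_Vert i \<in> tr (Suc m) (Path_Vert m)"
          unfolding transmitters_Suc with_proj_simps by blast
        moreover have "finite (tr (Suc m) (Path_Vert m))"
          by (rule finite_tr)
        ultimately have "\<alpha> * w m (Path_Vert i) \<le> (\<Sum>v\<in>tr (Suc m) (Path_Vert m). \<alpha> * w m v)"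
          using weight_nonneg alpha_pos by (intro member_le_sum) auto
        moreover have "\<alpha> ^ Suc m * real l \<le> \<alpha> * w m (Path_Vert i)"
          using wi alpha_pos by simp
        ultimately show ?thesis
          using weight_nonneg[of m "Path_Vert m"] by (simp add: weight_Suc_sum)
      qed
      \<comment> \<open>Apart from \<open>x\<close>, a path vertex beyond position \<open>m\<close>
        has no filled neighbor at time \<open>m\<close>. For \<open>x\<close> only
        \<open>m = 0\<close> is possible, and there the bound on \<open>s - 1\<close> pendants
        decides.\<close>
      have tail: "w (Suc m) (Path_Vert j) < \<beta>" if "m < j" for j
      proof (cases "j = 1")
        case False
        have "senders (Suc m) (Path_Vert j) = {}"
        proof (rule ccontr)
          assume "senders (Suc m) (Path_Vert j) \<noteq> {}"
          then obtain z where z: "z \<in> senders (Suc m) (Path_Vert j)" by blast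
          then have "z \<in> F m" using senders_subset_F[of "Suc m"] by auto
          moreover have "z = Path_Vert (j - 1) \<or> z = Path_Vert (j + 1)"
            using senders_arc[OF z] pendant_broom_path_nbrs[of z j s l k] that False
            by (auto simp: parcs)
          ultimately show False using Fm path_in_B that by auto
        qed
        then show ?thesis
          using weight_senders[of "Suc m" "Path_Vert j"] path_in_B beta_pos by simp
      next
        case True
        then have "m = 0" using that by simp
        have "tr (Suc 0) (Path_Vert 1) \<subseteq> Pendant ` {1..s - 1}"
        proof
          fix z assume z: "z \<in> tr (Suc 0) (Path_Vert 1)"
          then show "z \<in> Pendant ` {1..s - 1}"
            using trD(1)[OF z] trD(4)[OF z] by (cases z) (auto simp: filled_0 broom B_def)
        qed
        then have "card (tr (Suc 0) (Path_Vert 1)) \<le> card (Pendant ` {1..s - 1})"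
          by (rule card_mono[rotated]) simp
        also have "\<dots> = s - 1"
          by (simp add: card_image inj_on_def)
        finally have "\<alpha> * real (card (tr (Suc 0) (Path_Vert 1))) \<le> \<alpha> * real (s - 1)"
          using alpha_pos by simp
        moreover have "w 1 (Path_Vert 1) = \<alpha> * real (card (tr (Suc 0) (Path_Vert 1)))"
          using trD(1)[of _ 0 "Path_Vert 1"] path_in_B
          by (simp add: weight_Suc_sum weight_0 filled_0)
        ultimately show ?thesis using s True \<open>m = 0\<close> by simp
      qed
      have "F (Suc m) = B \<union> Path_Vert ` {..<Suc m}"
      proof -
        have "Path_Vert j \<in> F (Suc m) \<longleftrightarrow> j < Suc m" for j
          using Fm path_in_B m head big[OF m] tail[of j]
          by (auto simp: filled_Suc broom less_Suc_eq not_le intro: linorder_neqE_nat)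
        then show ?thesis
          using F_subset[of "Suc m"] B_subset_F[of "Suc m"] by (auto simp: pverts_eq)
      qed
      then show ?thesis using head Suc by simp
    qed
  qed
  have "F (k + 1) = pverts G"
    using inv[of "k + 1"] by (auto simp: pverts_eq)
  then have "is_tzf_set \<alpha> \<beta> G B"
    using B_subset by (auto simp: is_tzf_set_def)
  then show ?thesis by (simp add: G_def B_def)
qed

section \<open>The minimum and the choice of the parameters\<close>

lemma finite_tzf_sets:
  assumes "finite (pverts G)"
  shows "finite {B. is_tzf_set \<alpha> \<beta> G B}"
  by (rule finite_subset[of _ "Pow (pverts G)"]) (use assms in \<open>auto simp: is_tzf_set_def\<close>)

lemma tzf_number_le:
  assumes "finite (pverts G)" "is_tzf_set \<alpha> \<beta> G B"
  shows "tzf_number \<alpha> \<beta> G \<le> card B"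
  unfolding tzf_number_def using assms(2) finite_tzf_sets[OF assms(1)] by (intro Min_le) auto

lemma tzf_number_attained:
  assumes "finite (pverts G)"
  obtains B where "is_tzf_set \<alpha> \<beta> G B" "tzf_number \<alpha> \<beta> G = card B"
proof -
  have "tzf_number \<alpha> \<beta> G \<in> card ` {B. is_tzf_set \<alpha> \<beta> G B}"
    unfolding tzf_number_def using is_tzf_set_pverts finite_tzf_sets[OF assms]
    by (intro Min_in) auto
  then show ?thesis using that by auto
qed

theorem theorem5p2p2:
  fixes \<alpha> \<beta> :: real and t :: nat
  assumes "0 < \<alpha>" and "\<alpha> < 1" and "0 < \<beta>" and "\<beta> < 1" and "t > 0"
  shows "\<exists>k l s :: nat. k > 0 \<and> l > 0 \<and> s > 0 \<and>
    int (tzf_number \<alpha> \<beta> (pendant_broom s l k))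
      - int (tzf_number \<alpha> \<beta> (delete_edge (pendant_broom s l k) vert_x (Pendant s))) \<ge> int t"
proof -
  define s where "s = (LEAST s. \<beta> \<le> \<alpha> * real s)"
  have ex: "\<exists>s. \<beta> \<le> \<alpha> * real s"
    using real_arch_simple[of "\<beta> / \<alpha>"] assms(1) by (auto simp: field_simps)
  have s: "\<beta> \<le> \<alpha> * real s"
    unfolding s_def using ex by (rule LeastI_ex)
  then have "0 < s"
    using assms(3) by (cases s) auto
  then have s': "\<alpha> * real (s - 1) < \<beta>"
    using not_less_Least[of "s - 1" "\<lambda>s. \<beta> \<le> \<alpha> * real s"] by (simp add: s_def not_le)
  obtain L where "\<alpha> ^ L < \<beta> / (real s + 3)"
    using real_arch_pow_inv[of "\<beta> / (real s + 3)" \<alpha>] assms by auto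
  then have L: "\<alpha> ^ L * (real s + 3) < \<beta>"
    by (simp add: field_simps)
  then have "0 < L"
    using assms(4) by (cases L) auto
  \<comment> \<open>The lower bound gives away 2, for one leaf and one pendant; two extra windows
    make up for it.\<close>
  define k where "k = 3 + (t + 2) * (2 * L + 1)"
  \<comment> \<open>\<open>l\<close> can be chosen after \<open>k\<close>, since the lower bound
    with the edge present holds for every number of leaves.\<close>
  obtain l where "\<beta> / \<alpha> ^ (k + 1) \<le> real l"
    using real_arch_simple by blast
  then have l: "\<beta> \<le> \<alpha> ^ (k + 1) * real l"
    using assms(1) by (simp add: field_simps)
  then have "0 < l"
    using assms(3) by (cases l) auto
  let ?G = "pendant_broom s l k" and ?B = "Star_Leaf ` {1..l} \<union> Pendant ` {1..s}"
  obtain B where B: "is_tzf_set \<alpha> \<beta> ?G B" "tzf_number \<alpha> \<beta> ?G = card B"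
    using tzf_number_attained finite_pverts_pendant_broom by blast
  have "l + s + t \<le> tzf_number \<alpha> \<beta> ?G"
    using card_tzf_set_pendant_broom[OF assms(1-3) s \<open>0 < L\<close> L k_def B(1)] B(2) by simp
  moreover have "tzf_number \<alpha> \<beta> (delete_edge ?G vert_x (Pendant s)) \<le> card ?B"
    using is_tzf_set_delete_edge_pendant_broom[OF assms(1-3) \<open>0 < s\<close> s' l]
    by (intro tzf_number_le) (simp add: delete_edge_def finite_pverts_pendant_broom)
  moreover have "card ?B = l + s"
    by (subst card_Un_disjoint) (auto simp: card_image inj_on_def)
  ultimately show ?thesis
    using \<open>0 < s\<close> \<open>0 < l\<close> by (intro exI[of _ k] exI[of _ l] exI[of _ s]) (simp add: k_def)
qed

end
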